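(* Let $c,d$ be positive integers and $r\in\mathbb{Z}$. Assume that there are only finitely many natural numbers $n$ that cannot be written in the form $n=cp+T_x$ with $x\in\mathbb{Z}$, where $p$ is either $0$ or a prime with $p\equiv r\pmod d$. Then both $c$ and $d$ are powers of two, and $\gcd(r,d)=1$.
   Context: For $x\in\mathbb{Z}$, $T_x=x(x+1)/2$ denotes the $x$-th triangular number. Natural numbers are $0,1,2,\ldots$. Powers of two include $2^0=1$. *)

theory Defs
  imports "HOL-Number_Theory.Number_Theory"
begin

definition triangular :: "int \<Rightarrow> int" where
  "triangular x = x * (x + 1) div 2"

definition representable :: "nat \<Rightarrow> nat \<Rightarrow> int \<Rightarrow> nat \<Rightarrow> bool" where
  "representable c d r n \<longleftrightarrow>
     (\<exists>(p::nat) (x::int). (p = 0 \<or> prime p \<and> [int p = r] (mod int d)) \<and>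
        int n = int c * int p + triangular x)"

end

theory Submission
  imports Defs
begin

text \<open>
  For an odd \<open>q > 1\<close> the triangular numbers miss a residue class modulo \<open>q\<close>, because
  \<open>T\<^sub>0 \<equiv> T\<^bsub>q-1\<^esub> \<equiv> 0\<close>. If an odd prime \<open>q\<close> divides \<open>c d\<close>, then \<open>c p \<equiv> c r\<close> modulo \<open>q\<close> for every
  admissible prime \<open>p\<close>, so in a suitable residue class modulo \<open>q\<close> only the triangular numbers
  themselves are representable; but gaps between triangular numbers grow. If a prime \<open>g\<close> divides
  \<open>r\<close> and \<open>d\<close>, then \<open>p = g\<close> is the only possible admissible prime, and the growing gaps again
  leave infinitely many numbers that are neither triangular nor \<open>c g\<close> plus a triangular number.
\<close>

lemma two_mult_triangular: "2 * triangular x = x * (x + 1)"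
  unfolding triangular_def by simp

lemma triangular_reflect: "triangular (- 1 - x) = triangular x"
  by (simp add: triangular_def algebra_simps)

lemma triangular_mono:
  assumes "0 \<le> x" "x \<le> y"
  shows "triangular x \<le> triangular y"
  using mult_mono[of x y "x + 1" "y + 1"] two_mult_triangular[of x] two_mult_triangular[of y] assms
  by linarith

lemma triangular_add_one: "triangular (x + 1) = triangular x + x + 1"
  using two_mult_triangular[of x] two_mult_triangular[of "x + 1"] by (simp add: algebra_simps)

lemma le_triangular:
  assumes "0 \<le> x"
  shows "x \<le> triangular x"
proof (cases "x = 0")
  case False
  then have "x * 2 \<le> x * (x + 1)"
    using assms by (intro mult_left_mono) auto
  then show ?thesis
    using two_mult_triangular[of x] by linarith
qed (simp add: triangular_def)

lemma not_triangular_between: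
  assumes "0 \<le> m" "triangular m < y" "y < triangular m + m + 1"
  shows "y \<noteq> triangular x"
proof -
  have "y \<noteq> triangular z" if "0 \<le> z" for z
    using triangular_mono[of z m] triangular_mono[of "m + 1" z] triangular_add_one[of m] that assms
    by linarith
  \<comment> \<open>One of \<open>x\<close> and \<open>- 1 - x\<close> is nonnegative, and both give
    the same triangular number.\<close>
  from this[of x] this[of "- 1 - x"] show ?thesis
    using triangular_reflect[of x] by linarith
qed

lemma triangular_cong:
  assumes "odd q" "[x = y] (mod q)"
  shows "[triangular x = triangular y] (mod q)"
proof -
  have "[x * (x + 1) = y * (y + 1)] (mod q)"
    using assms(2) by (intro cong_mult cong_add cong_refl)
  then have "[2 * triangular x = 2 * triangular y] (mod q)"
    by (simp only: two_mult_triangular)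
  moreover have "coprime 2 q"
    using assms(1) by simp
  ultimately show ?thesis
    using cong_mult_lcancel by blast
qed

lemma triangular_misses_residue:
  assumes "odd q" "q > 1"
  obtains a where "\<And>x. \<not> [triangular x = a] (mod q)"
proof -
  let ?f = "\<lambda>x. triangular x mod q"
  have "q dvd triangular (q - 1)"
  proof -
    have "q dvd 2 * triangular (q - 1)"
      by (simp add: two_mult_triangular)
    then show ?thesis
      using assms(1) by (simp add: coprime_commute coprime_dvd_mult_right_iff)
  qed
  then have "?f (q - 1) = ?f 0"
    by (simp add: triangular_def)
  then have "\<not> inj_on ?f {0..<q}"
    using assms(2) by (auto dest!: inj_onD[where x = "q - 1" and y = 0])
  \<comment> \<open>Pigeonhole: a self-map of a finite set that is not injective is not surjective,
    so some residue is missed.\<close>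
  then have "?f ` {0..<q} \<noteq> {0..<q}"
    using eq_card_imp_inj_on[of "{0..<q}" ?f] by auto
  moreover have "?f ` {0..<q} \<subseteq> {0..<q}"
    using assms(2) by auto
  ultimately obtain a where a: "a \<in> {0..<q}" "a \<notin> ?f ` {0..<q}"
    by blast
  have "\<not> [triangular x = a] (mod q)" for x
  proof
    assume "[triangular x = a] (mod q)"
    moreover have "[triangular (x mod q) = triangular x] (mod q)"
      by (intro triangular_cong assms(1)) (simp add: cong_def)
    ultimately have "?f (x mod q) = a"
      using a(1) by (simp add: cong_def)
    moreover have "x mod q \<in> {0..<q}"
      using assms(2) by simp
    ultimately show False
      using a(2) by blast
  qed
  then show thesis
    by (rule that)
qed

text \<open>The \<open>m\<close> integers strictly between \<open>triangular m\<close> and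
  \<open>triangular (m + 1)\<close> cover all residues modulo \<open>q\<close> once
  \<open>m \<ge> q\<close>.\<close>

lemma nontriangular_in_residue_class:
  assumes "q > 0"
  obtains n :: nat where "n \<ge> N" "[int n = a] (mod q)" "\<And>x. int n \<noteq> triangular x"
proof -
  define m where "m = max (int N) q"
  \<comment> \<open>The least integer above \<open>triangular m\<close> congruent to
    \<open>a\<close>: its distance from \<open>triangular m\<close> is at most
    \<open>q \<le> m\<close>, so it stays inside the gap.\<close>
  define y where "y = triangular m + 1 + (a - triangular m - 1) mod q"
  have m: "0 \<le> m" "int N \<le> m" "q \<le> m"
    using assms by (auto simp: m_def)
  have y: "triangular m < y" "y < triangular m + m + 1"
    using pos_mod_bound[OF assms, of "a - triangular m - 1"]
      pos_mod_sign[OF assms, of "a - triangular m - 1"] m by (auto simp: y_def)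
  have "[y = triangular m + 1 + (a - triangular m - 1)] (mod q)"
    unfolding y_def by (simp add: cong_def mod_simps)
  then have "[y = a] (mod q)"
    by simp
  moreover have "int N \<le> y"
    using le_triangular[of m] m y by linarith
  ultimately show thesis
    using that[of "nat y"] not_triangular_between[OF m(1) y] by auto
qed

lemma power_of_two_if_no_odd_prime_divisor:
  fixes n :: nat
  assumes "n > 0" "\<And>q. prime q \<Longrightarrow> odd q \<Longrightarrow> \<not> q dvd n"
  shows "\<exists>a. n = 2 ^ a"
proof -
  obtain m where m: "n = 2 ^ multiplicity 2 n * m" "\<not> 2 dvd m"
    using multiplicity_decompose'[of n 2] assms(1) by auto
  have "m = 1"
  proof (rule ccontr)
    assume "m \<noteq> 1"
    then obtain q where "prime q" "q dvd m"
      using prime_factor_nat by blast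
    then show False
      using assms(2)[of q] m by (metis dvd_mult dvd_trans)
  qed
  then show ?thesis
    using m(1) by auto
qed

lemma no_odd_prime_dvd_if_cofinite_representable:
  assumes "\<And>n. n \<ge> N \<Longrightarrow> representable c d r n" "prime q" "odd q"
  shows "\<not> q dvd c * d"
proof
  assume q: "q dvd c * d"
  have "int q > 1" "odd (int q)"
    using assms(2,3) prime_gt_1_nat by auto
  then obtain a where a: "\<And>x. \<not> [triangular x = a] (mod int q)"
    using triangular_misses_residue by blast
  \<comment> \<open>Being nontriangular excludes \<open>p = 0\<close>; the residue is chosen so that
    \<open>c * p \<equiv> c * r\<close> would force \<open>triangular x \<equiv> a\<close>, the
    missed class.\<close>
  obtain n where n: "n \<ge> N" "[int n = int c * r + a] (mod int q)" "\<And>x. int n \<noteq> triangular x"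
    using nontriangular_in_residue_class[of "int q"] \<open>int q > 1\<close> by auto
  obtain p x where px: "p = 0 \<or> prime p \<and> [int p = r] (mod int d)"
    "int n = int c * int p + triangular x"
    using assms(1)[OF n(1)] unfolding representable_def by blast
  have "[int p = r] (mod int d)"
    using px n(3)[of x] by auto
  \<comment> \<open>Scaling by \<open>c\<close> turns the modulus into \<open>c * d\<close>, so the
    cases \<open>q dvd c\<close> and \<open>q dvd d\<close> are handled together.\<close>
  then have "int c * int d dvd int c * (int p - r)"
    by (simp add: cong_iff_dvd_diff)
  moreover have "int q dvd int c * int d"
    using q by (metis int_dvd_int_iff of_nat_mult)
  ultimately have "[int c * int p = int c * r] (mod int q)"
    by (metis cong_iff_dvd_diff dvd_trans right_diff_distrib)
  then have "[int c * int p + triangular x = int c * r + triangular x] (mod int q)"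
    by (intro cong_add cong_refl)
  then have "[int c * r + triangular x = int c * r + a] (mod int q)"
    using n(2) px(2) cong_sym cong_trans by metis
  then show False
    using a cong_add_lcancel by blast
qed

lemma coprime_if_cofinite_representable:
  assumes "\<And>n. n \<ge> N \<Longrightarrow> representable c d r n"
  shows "coprime r (int d)"
proof (rule ccontr)
  assume "\<not> coprime r (int d)"
  then have "nat (gcd r (int d)) \<noteq> 1"
    by (auto simp: coprime_iff_gcd_eq_1 nat_eq_iff)
  then obtain g where g: "prime g" "g dvd nat (gcd r (int d))"
    using prime_factor_nat by blast
  then have gd: "int g dvd r" "int g dvd int d"
    by (metis dvd_trans gcd_dvd1 gcd_dvd2 gcd_ge_0_int int_dvd_int_iff int_nat_eq)+
  define k where "k = int c * int g"
  \<comment> \<open>\<open>m > k\<close> puts both \<open>n - k = triangular m + 1\<close> and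
    \<open>n = triangular m + k + 1\<close> in the gap after \<open>triangular m\<close>. The second
    excludes \<open>p = 0\<close>, the first \<open>p = g\<close>; the summand \<open>N\<close>
    makes \<open>n \<ge> N\<close>.\<close>
  define m where "m = int N + k + 1"
  define n where "n = nat (triangular m + k + 1)"
  have "k \<ge> 0"
    by (simp add: k_def)
  then have m: "m \<ge> 0" "m \<ge> int N" "m > k"
    by (auto simp: m_def)
  have n: "int n = triangular m + k + 1" "n \<ge> N"
    using le_triangular[of m] m \<open>k \<ge> 0\<close> by (auto simp: n_def)
  have not_tri: "int n \<noteq> triangular x" "int n - k \<noteq> triangular x" for x
    using not_triangular_between[OF m(1), of "int n"] not_triangular_between[OF m(1), of "int n - k"]
      n(1) m \<open>k \<ge> 0\<close> by auto
  obtain p x where px: "p = 0 \<or> prime p \<and> [int p = r] (mod int d)"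
    "int n = int c * int p + triangular x"
    using assms(1)[OF n(2)] unfolding representable_def by blast
  then have p: "prime p" "[int p = r] (mod int d)"
    using not_tri(1)[of x] by auto
  have "int g dvd int p"
    using cong_dvd_iff[OF cong_dvd_modulus[OF p(2) gd(2)]] gd(1) by simp
  then have "p = g"
    using g(1) p(1) primes_dvd_imp_eq by auto
  then show False
    using px(2) not_tri(2)[of x] by (simp add: k_def)
qed

theorem theorem1p1:
  fixes c d :: nat and r :: int
  assumes "c > 0" and "d > 0"
    and "finite {n::nat. \<not> representable c d r n}"
  shows "(\<exists>a::nat. c = 2 ^ a) \<and> (\<exists>b::nat. d = 2 ^ b) \<and> gcd r (int d) = 1"
proof -
  obtain N where "\<forall>n \<in> {n. \<not> representable c d r n}. n < N"
    using assms(3) finite_nat_set_iff_bounded by auto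
  then have N: "\<And>n. n \<ge> N \<Longrightarrow> representable c d r n"
    by force
  note no_prime = no_odd_prime_dvd_if_cofinite_representable[OF N]
  show ?thesis
    using power_of_two_if_no_odd_prime_divisor[OF assms(1)]
      power_of_two_if_no_odd_prime_divisor[OF assms(2)]
      coprime_if_cofinite_representable[OF N] no_prime
    by (metis coprime_iff_gcd_eq_1 dvd_mult dvd_mult2)
qed

end
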